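(* For any positive Borel measure $d\mu$ supported on $E\subseteq\mathbb{R}$ with corresponding semi-infinite symmetric Jacobi matrix $\mathbf{J}$, and $c\notin E$, let $\mathbf{J}_{[2]}$ be the semi-infinite symmetric Jacobi matrix corresponding to the $2$-iterated perturbed measure $(x-c)^2d\mu$. Then $$(\mathbf{J}_{[2]}-c\mathbf{I})^2=\mathbf{R}\mathbf{R}^\intercal=\mathbf{T}^\intercal\mathbf{T}.$$
   Context: $\mu$ has infinite support contained in an interval $E\subseteq\mathbb{R}$ (bounded or unbounded), all its moments are finite; $c\in\mathbb{R}\setminus E$ and $M,N\ge0$. $\bar{\mathbf{p}}=[p_0,p_1,\dots]^\intercal$ and $\bar{\mathbf{p}}^{[2]}=[p_0^{[2]},p_1^{[2]},\dots]^\intercal$ are the vectors of orthonormal polynomials (positive leading coefficients) with respect to $d\mu$ and $(x-c)^2d\mu$ respectively; $\mathbf{J}$ and $\mathbf{J}_{[2]}$ are the symmetric tridiagonal matrices with $x\bar{\mathbf{p}}=\mathbf{J}\bar{\mathbf{p}}$ and $x\bar{\mathbf{p}}^{[2]}=\mathbf{J}_{[2]}\bar{\mathbf{p}}^{[2]}$. Matrix $\mathbf{R}$: put $\varepsilon=1$ if $c$ lies to the left of $E$ and $\varepsilon=-1$ if $c$ lies to the right of $E$. Let $\varepsilon(\mathbf{J}-c\mathbf{I})=\mathbf{L}\mathbf{L}^\intercal$ be the Cholesky factorization, with $\mathbf{L}$ lower bidiagonal with positive diagonal entries, and let $\mathbf{L}^\intercal\mathbf{L}=\mathbf{L}_1\mathbf{L}_1^\intercal$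 be the Cholesky factorization of $\mathbf{L}^\intercal\mathbf{L}$, with $\mathbf{L}_1$ lower bidiagonal with positive diagonal entries. Then $\mathbf{R}=(\mathbf{L}\mathbf{L}_1)^\intercal$, an upper triangular matrix. Matrix $\mathbf{T}$: let $s_n^{M,N}$ be the polynomials of degree $n$ with positive leading coefficient orthonormal with respect to $\langle f,g\rangle_S=\int_Efg\,d\mu+Mf(c)g(c)+Nf'(c)g'(c)$. $\mathbf{T}$ is the lower triangular semi-infinite matrix with positive diagonal entries determined by $[s_0^{M,N},s_1^{M,N},\dots]^\intercal=\mathbf{T}\,\bar{\mathbf{p}}^{[2]}$ (row $n$ has nonzero entries only in columns $n-2,n-1,n$). *)

theory Defs
  imports
    "HOL-Analysis.Analysis"
    "HOL-Computational_Algebra.Polynomial"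
begin

definition supp :: "real measure \<Rightarrow> real set" where
  "supp \<mu> = {x. \<forall>U. open U \<longrightarrow> x \<in> U \<longrightarrow> emeasure \<mu> U > 0}"

text \<open>The moment of order 0 is included, so the measure is finite.\<close>

definition finite_moments :: "real measure \<Rightarrow> bool" where
  "finite_moments \<mu> \<longleftrightarrow> (\<forall>n::nat. integrable \<mu> (\<lambda>x. x ^ n))"

definition orthonormal_polys ::
    "(real poly \<Rightarrow> real poly \<Rightarrow> real) \<Rightarrow> (nat \<Rightarrow> real poly) \<Rightarrow> bool" where
  "orthonormal_polys ip p \<longleftrightarrow>
     (\<forall>n. degree (p n) = n \<and> lead_coeff (p n) > 0) \<and>
     (\<forall>m n. ip (p m) (p n) = (if m = n then 1 else 0))"

definition the_orthonormal_polys ::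
    "(real poly \<Rightarrow> real poly \<Rightarrow> real) \<Rightarrow> nat \<Rightarrow> real poly" where
  "the_orthonormal_polys ip = (THE p. orthonormal_polys ip p)"

definition measure_ip :: "real measure \<Rightarrow> real poly \<Rightarrow> real poly \<Rightarrow> real" where
  "measure_ip \<mu> f g = (\<integral>x. poly f x * poly g x \<partial>\<mu>)"

definition sobolev_ip ::
    "real measure \<Rightarrow> real set \<Rightarrow> real \<Rightarrow> real \<Rightarrow> real \<Rightarrow> real poly \<Rightarrow> real poly \<Rightarrow> real" where
  "sobolev_ip \<mu> E c M N f g =
     (LINT x:E|\<mu>. poly f x * poly g x)
     + M * poly f c * poly g c
     + N * poly (pderiv f) c * poly (pderiv g) c"

definition op_polys :: "real measure \<Rightarrow> nat \<Rightarrow> real poly" where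
  "op_polys \<mu> = the_orthonormal_polys (measure_ip \<mu>)"

definition sobolev_polys ::
    "real measure \<Rightarrow> real set \<Rightarrow> real \<Rightarrow> real \<Rightarrow> real \<Rightarrow> nat \<Rightarrow> real poly" where
  "sobolev_polys \<mu> E c M N = the_orthonormal_polys (sobolev_ip \<mu> E c M N)"

definition iterated_measure :: "real measure \<Rightarrow> real \<Rightarrow> real measure" where
  "iterated_measure \<mu> c = density \<mu> (\<lambda>x. ennreal ((x - c)\<^sup>2))"

type_synonym smat = "nat \<Rightarrow> nat \<Rightarrow> real"

text \<open>The entries of all products used here are sums with finitely many nonzero terms.\<close>

definition smat_mult :: "smat \<Rightarrow> smat \<Rightarrow> smat"  (infixl "\<otimes>\<^sub>m" 70) where
  "A \<otimes>\<^sub>m B = (\<lambda>i j. \<Sum>k. A i k * B k j)"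

definition smat_transpose :: "smat \<Rightarrow> smat" where
  "smat_transpose A = (\<lambda>i j. A j i)"

definition smat_id :: smat where
  "smat_id = (\<lambda>i j. if i = j then 1 else 0)"

definition smat_minus :: "smat \<Rightarrow> smat \<Rightarrow> smat"  (infixl "\<ominus>\<^sub>m" 65) where
  "A \<ominus>\<^sub>m B = (\<lambda>i j. A i j - B i j)"

definition smat_scale :: "real \<Rightarrow> smat \<Rightarrow> smat"  (infixr "\<cdot>\<^sub>m" 75) where
  "a \<cdot>\<^sub>m A = (\<lambda>i j. a * A i j)"

text \<open>
  Action on a vector of polynomials. It is applied only to matrices whose rows have finitely
  many nonzero entries; for infinitely many, \<^const>\<open>sum\<close> would return 0.
\<close>

definition smat_vec :: "smat \<Rightarrow> (nat \<Rightarrow> real poly) \<Rightarrow> nat \<Rightarrow> real poly"  (infixr "\<cdot>\<^sub>v" 75) where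
  "A \<cdot>\<^sub>v p = (\<lambda>i. \<Sum>k | A i k \<noteq> 0. smult (A i k) (p k))"

definition symmetric_tridiagonal :: "smat \<Rightarrow> bool" where
  "symmetric_tridiagonal A \<longleftrightarrow>
     smat_transpose A = A \<and> (\<forall>i j. A i j \<noteq> 0 \<longrightarrow> i \<le> j + 1 \<and> j \<le> i + 1)"

definition lower_triangular :: "smat \<Rightarrow> bool" where
  "lower_triangular A \<longleftrightarrow> (\<forall>i j. A i j \<noteq> 0 \<longrightarrow> j \<le> i)"

definition lower_bidiagonal :: "smat \<Rightarrow> bool" where
  "lower_bidiagonal A \<longleftrightarrow> (\<forall>i j. A i j \<noteq> 0 \<longrightarrow> j \<le> i \<and> i \<le> j + 1)"

definition positive_diagonal :: "smat \<Rightarrow> bool" where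
  "positive_diagonal A \<longleftrightarrow> (\<forall>i. A i i > 0)"

definition cholesky :: "smat \<Rightarrow> smat" where
  "cholesky A = (THE L. lower_bidiagonal L \<and> positive_diagonal L \<and> A = L \<otimes>\<^sub>m smat_transpose L)"

definition jacobi_matrix :: "real measure \<Rightarrow> smat" where
  "jacobi_matrix \<mu> = (THE J. symmetric_tridiagonal J \<and>
     (\<lambda>n. [:0, 1:] * op_polys \<mu> n) = J \<cdot>\<^sub>v op_polys \<mu>)"

text \<open>For an interval not containing \<open>c\<close>, the second case is that \<open>c\<close> lies to its right.\<close>

definition side_sign :: "real set \<Rightarrow> real \<Rightarrow> real" where
  "side_sign E c = (if \<forall>x\<in>E. c < x then 1 else - 1)"

definition R_matrix :: "real measure \<Rightarrow> real set \<Rightarrow> real \<Rightarrow> smat" where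
  "R_matrix \<mu> E c =
     (let L = cholesky (side_sign E c \<cdot>\<^sub>m (jacobi_matrix \<mu> \<ominus>\<^sub>m c \<cdot>\<^sub>m smat_id));
          L\<^sub>1 = cholesky (smat_transpose L \<otimes>\<^sub>m L)
      in smat_transpose (L \<otimes>\<^sub>m L\<^sub>1))"

definition T_matrix ::
    "real measure \<Rightarrow> real set \<Rightarrow> real \<Rightarrow> real \<Rightarrow> real \<Rightarrow> smat" where
  "T_matrix \<mu> E c M N = (THE T. lower_triangular T \<and> positive_diagonal T \<and>
     sobolev_polys \<mu> E c M N = T \<cdot>\<^sub>v op_polys (iterated_measure \<mu> c))"

end

theory Submission
  imports Defs
begin

text \<open>
  The matrices are Gram matrices between orthonormal bases. If two inner products satisfy
  \<open>b f g = a (w * f) g\<close> for a polynomial \<open>w\<close>, with orthonormal bases \<open>p\<close> and \<open>q\<close>, then the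
  matrix \<open>L i j = b (p i) (q j)\<close> is lower triangular, and Parseval's identity shows that
  \<open>L L\<^sup>T\<close> represents multiplication by \<open>w\<close> in the basis \<open>p\<close>, and \<open>L\<^sup>T L\<close> multiplication by \<open>w\<close> in
  the basis \<open>q\<close>. For \<open>w = \<plusminus>(x - c)\<close> this identifies the Cholesky factors. Both \<open>R\<^sup>T\<close> and \<open>T\<close>
  are of this form with \<open>w = (x - c)\<^sup>2\<close>, with \<open>a\<close> the inner product of \<open>\<mu>\<close> or the
  Sobolev one: the mass terms vanish on multiples of \<open>(x - c)\<^sup>2\<close>.
\<close>

section \<open>Orthonormal polynomials of an inner product\<close>

text \<open>An abstract inner product on polynomials, because the proof needs four of them: three
  given by integrals and the Sobolev one. Linearity in the second argument follows by
  symmetry.\<close>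

locale poly_inner =
  fixes ip :: "real poly \<Rightarrow> real poly \<Rightarrow> real"
  assumes add: "ip (f + g) h = ip f h + ip g h"
    and smult: "ip (smult r f) h = r * ip f h"
    and commute: "ip f g = ip g f"
    and pos: "f \<noteq> 0 \<Longrightarrow> ip f f > 0"
begin

lemma zero [simp]: "ip 0 f = 0" "ip f 0 = 0"
  using smult[of 0 0 f] commute[of f 0] by auto

lemma diff: "ip (f - g) h = ip f h - ip g h"
  using add[of f "smult (-1) g" h] smult[of "-1" g h] by simp

lemma smult_right: "ip f (smult r g) = r * ip f g"
  using smult commute by metis

lemma add_right: "ip f (g + h) = ip f g + ip f h"
  using add commute by metis

lemma diff_right: "ip f (g - h) = ip f g - ip f h"
  using diff commute by metis

lemma sum_left: "ip (sum F A) h = (\<Sum>k\<in>A. ip (F k) h)"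
  by (induction A rule: infinite_finite_induct) (auto simp: add)

lemma eq_zeroI: "ip f f = 0 \<Longrightarrow> f = 0"
  using pos by force

text \<open>The \<open>p k\<close> with \<open>k < n\<close> span the polynomials of degree below
  \<open>n\<close>; the induction strips off leading terms. Only indices below \<open>n\<close> are
  constrained, so the lemma applies in the middle of Gram-Schmidt.\<close>

lemma orthogonal_lower_degree:
  assumes "\<And>k. k < n \<Longrightarrow> degree (p k) = k" "\<And>k. k < n \<Longrightarrow> coeff (p k) k > 0"
    and "\<And>k. k < n \<Longrightarrow> ip g (p k) = 0" and "degree h < n"
  shows "ip g h = 0"
  using assms
proof (induction n arbitrary: h)
  case (Suc n)
  define t where "t = coeff h n / coeff (p n) n"
  define h' where "h' = h - smult t (p n)"
  have p: "degree (p n) = n" "coeff (p n) n > 0"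
    using Suc.prems(1,2)[of n] by auto
  have "degree h' \<le> n" unfolding h'_def
    using Suc.prems(4) p by (intro degree_diff_le) auto
  moreover have "coeff h' n = 0" using p by (simp add: h'_def t_def)
  ultimately have "h' = 0 \<or> degree h' < n" by (rule eq_zero_or_degree_less)
  then have "ip g h' = 0" using Suc.IH[of h'] Suc.prems(1-3) by (auto simp: less_SucI)
  moreover have "h = h' + smult t (p n)" by (simp add: h'_def)
  ultimately show ?case using Suc.prems(3)[of n] by (simp add: add_right smult_right)
qed simp

text \<open>Gram-Schmidt on the monomials. Orthogonality to every polynomial of lower degree makes
  the claim for \<open>n\<close> independent of the choices made for smaller degrees.\<close>

lemma ex_orthonormal_poly:
  "\<exists>q. degree q = n \<and> lead_coeff q > 0 \<and> ip q q = 1 \<and> (\<forall>f. degree f < n \<longrightarrow> ip q f = 0)"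
proof (induction n rule: less_induct)
  case (less n)
  then obtain p where p: "\<And>k. k < n \<Longrightarrow> degree (p k) = k \<and> lead_coeff (p k) > 0 \<and>
      ip (p k) (p k) = 1 \<and> (\<forall>f. degree f < k \<longrightarrow> ip (p k) f = 0)"
    by metis
  \<comment> \<open>The orthogonal projection of the monomial onto the span of the earlier
    polynomials; subtracting it keeps the leading coefficient 1.\<close>
  define s where "s = (\<Sum>k<n. smult (ip (monom 1 n) (p k)) (p k))"
  define q where "q = monom 1 n - s"
  have "coeff s m = 0" if "m \<ge> n" for m
    using that p unfolding s_def coeff_sum by (intro sum.neutral) (auto intro: coeff_eq_0)
  then have coeff: "coeff q n = 1" and le: "degree q \<le> n"
    by (auto simp: q_def intro!: degree_le)
  then have deg: "degree q = n" by (metis le_degree le_antisym zero_neq_one)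
  have orth: "ip (p k) (p j) = (if k = j then 1 else 0)" if "k < n" "j < n" for k j
    using p[of k] p[of j] that commute[of "p k" "p j"] by (cases k j rule: linorder_cases) auto
  have s_orth: "ip s (p j) = ip (monom 1 n) (p j)" if "j < n" for j
  proof -
    have "ip s (p j) = (\<Sum>k<n. if k = j then ip (monom 1 n) (p k) else 0)"
      unfolding s_def sum_left using that by (intro sum.cong) (auto simp: smult orth)
    then show ?thesis using that by simp
  qed
  have q_orth: "ip q f = 0" if "degree f < n" for f
  proof (rule orthogonal_lower_degree[of n p])
    show "degree (p k) = k" if "k < n" for k using p[OF that] by simp
    show "coeff (p k) k > 0" if "k < n" for k using p[OF that] by metis
  qed (use s_orth that in \<open>auto simp: q_def diff\<close>)
  define r where "r = 1 / sqrt (ip q q)"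
  have "ip q q > 0" using coeff by (intro pos) auto
  then have "r > 0" "r * (r * ip q q) = 1" by (auto simp: r_def field_simps)
  then show ?case using coeff deg q_orth
    by (intro exI[of _ "smult r q"]) (auto simp: smult smult_right)
qed

lemma orthonormal_D:
  assumes "orthonormal_polys ip p"
  shows "degree (p n) = n" "coeff (p n) n > 0" "ip (p m) (p n) = (if m = n then 1 else 0)"
  using assms unfolding orthonormal_polys_def by metis+

lemma orthonormal_orthogonal:
  assumes "orthonormal_polys ip p" "degree f < n"
  shows "ip f (p n) = 0"
  unfolding commute[of f]
  by (rule orthogonal_lower_degree[of n p]) (use orthonormal_D[OF assms(1)] assms(2) in auto)

text \<open>Subtracting the right multiple of \<open>p n\<close> from \<open>f\<close> leaves a
  polynomial of lower degree, which is orthogonal to \<open>p n\<close>.\<close>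

lemma orthonormal_lead_coeff:
  assumes "orthonormal_polys ip p" "degree f \<le> n"
  shows "ip f (p n) = coeff f n / coeff (p n) n"
proof -
  note p = orthonormal_D[OF assms(1)]
  define t where "t = coeff f n / coeff (p n) n"
  define h where "h = f - smult t (p n)"
  have "degree h \<le> n" unfolding h_def
    using assms(2) p by (intro degree_diff_le) auto
  moreover have "coeff h n = 0" using p(2)[of n] by (simp add: h_def t_def)
  ultimately have "h = 0 \<or> degree h < n" by (rule eq_zero_or_degree_less)
  then have "ip h (p n) = 0" using orthonormal_orthogonal[OF assms(1)] by auto
  moreover have "f = h + smult t (p n)" by (simp add: h_def)
  ultimately have "ip f (p n) = t" using p(3)[of n n] by (metis add smult add_0 mult_1_right)
  then show ?thesis by (simp add: t_def)
qed

lemma orthonormal_polys_unique: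
  assumes "orthonormal_polys ip p" "orthonormal_polys ip q"
  shows "p = q"
proof
  fix n
  note p = orthonormal_D[OF assms(1)] and q = orthonormal_D[OF assms(2)]
  \<comment> \<open>Evaluating the same product in either family gives two reciprocal ratios of
    leading coefficients; both are positive, so they equal 1.\<close>
  have pq: "ip (p n) (q n) = coeff (p n) n / coeff (q n) n"
    using orthonormal_lead_coeff[OF assms(2)] p by simp
  have qp: "ip (p n) (q n) = coeff (q n) n / coeff (p n) n"
    using orthonormal_lead_coeff[OF assms(1), of "q n" n] q commute by simp
  have "coeff (p n) n * coeff (p n) n = coeff (q n) n * coeff (q n) n"
    using pq qp p(2)[of n] q(2)[of n] by (simp add: field_simps)
  then have "coeff (p n) n = coeff (q n) n"
    using p(2)[of n] q(2)[of n] by (simp add: square_eq_iff)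
  then have "ip (p n) (q n) = 1" using pq q(2)[of n] by simp
  moreover have "ip (q n) (p n) = ip (p n) (q n)" by (rule commute)
  ultimately have "ip (p n - q n) (p n - q n) = 0"
    using p(3)[of n n] q(3)[of n n] by (simp add: diff diff_right)
  then show "p n = q n" using eq_zeroI by fastforce
qed

lemma the_orthonormal_polys: "orthonormal_polys ip (the_orthonormal_polys ip)"
proof -
  obtain p where p: "\<And>n. degree (p n) = n \<and> lead_coeff (p n) > 0 \<and> ip (p n) (p n) = 1 \<and>
      (\<forall>f. degree f < n \<longrightarrow> ip (p n) f = 0)"
    using ex_orthonormal_poly by metis
  have orth: "ip (p m) (p n) = (if m = n then 1 else 0)" for m n
    using p[of m] p[of n] commute[of "p m" "p n"] by (cases m n rule: linorder_cases) auto
  have "orthonormal_polys ip p"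
    unfolding orthonormal_polys_def orth using p by blast
  then show ?thesis unfolding the_orthonormal_polys_def
    using orthonormal_polys_unique by (metis theI)
qed

section \<open>Expansions and Parseval's identity\<close>

lemma orthonormal_expansion:
  assumes "orthonormal_polys ip p" "finite A" "\<And>k. k \<notin> A \<Longrightarrow> ip f (p k) = 0"
  shows "f = (\<Sum>k\<in>A. smult (ip f (p k)) (p k))"
proof -
  note p = orthonormal_D[OF assms(1)]
  define h where "h = f - (\<Sum>k\<in>A. smult (ip f (p k)) (p k))"
  have orth: "ip h (p j) = 0" for j
  proof -
    have "(\<Sum>k\<in>A. ip f (p k) * ip (p k) (p j)) = (\<Sum>k\<in>A. if k = j then ip f (p k) else 0)"
      by (intro sum.cong) (auto simp: p)
    then show ?thesis
      using assms(2) assms(3)[of j] by (simp add: h_def diff sum_left smult)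
  qed
  \<comment> \<open>The remainder \<open>h\<close> is orthogonal to every \<open>p j\<close>, hence
    to all polynomials, itself included.\<close>
  have "ip h h = 0"
    by (rule orthogonal_lower_degree[of "Suc (degree h)" p]) (use p orth in auto)
  then show ?thesis using eq_zeroI[of h] by (simp add: h_def)
qed

text \<open>Stated with the series of \<open>smat_mult\<close>, so that it evaluates entries of
  products of Gram matrices directly; only indices up to \<open>degree f\<close> contribute.\<close>

lemma parseval:
  assumes "orthonormal_polys ip p"
  shows "(\<Sum>k. ip f (p k) * ip g (p k)) = ip f g"
proof -
  have f: "ip f (p k) = 0" if "k \<notin> {..degree f}" for k
    using that by (intro orthonormal_orthogonal[OF assms]) auto
  then have "(\<Sum>k. ip f (p k) * ip g (p k)) = (\<Sum>k\<le>degree f. ip f (p k) * ip g (p k))"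
    by (intro suminf_finite) auto
  also have "\<dots> = ip (\<Sum>k\<le>degree f. smult (ip f (p k)) (p k)) g"
    by (simp add: sum_left smult commute[of g])
  also have "\<dots> = ip f g"
    using orthonormal_expansion[OF assms finite_atMost f] by simp
  finally show ?thesis .
qed

lemma finite_ip_nonzero:
  assumes "orthonormal_polys ip p"
  shows "finite {k. ip f (p k) \<noteq> 0}"
proof (rule finite_subset)
  show "{k. ip f (p k) \<noteq> 0} \<subseteq> {..degree f}"
    using orthonormal_orthogonal[OF assms] not_le_imp_less by blast
qed simp

text \<open>Gives existence and uniqueness at once for the definite descriptions of the Jacobi
  matrix and of \<open>T_matrix\<close>.\<close>

lemma eq_smat_vec_iff:
  assumes "orthonormal_polys ip p" "\<And>i. finite {k. A i k \<noteq> 0}"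
  shows "f = A \<cdot>\<^sub>v p \<longleftrightarrow> A = (\<lambda>i j. ip (f i) (p j))"
proof
  assume f: "f = A \<cdot>\<^sub>v p"
  have "ip (f i) (p j) = A i j" for i j
  proof -
    have "ip (f i) (p j) = (\<Sum>k | A i k \<noteq> 0. if k = j then A i k else 0)"
      unfolding f smat_vec_def sum_left
      by (intro sum.cong) (auto simp: smult orthonormal_D[OF assms(1)])
    then show ?thesis using assms(2)[of i] by simp
  qed
  then show "A = (\<lambda>i j. ip (f i) (p j))" by simp
next
  assume A: "A = (\<lambda>i j. ip (f i) (p j))"
  show "f = A \<cdot>\<^sub>v p"
    unfolding A smat_vec_def
    by (intro ext orthonormal_expansion[OF assms(1) finite_ip_nonzero[OF assms(1)]]) simp
qed

end

section \<open>Multiplying the inner product by a polynomial\<close>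

locale christoffel = a: poly_inner a + b: poly_inner b for a b +
  fixes w :: "real poly" and p q :: "nat \<Rightarrow> real poly"
  assumes b_eq: "b f g = a (w * f) g"
    and p: "orthonormal_polys a p" and q: "orthonormal_polys b q"
begin

text \<open>The connection matrix: row \<open>i\<close> holds the coordinates of \<open>p i\<close>
  in the basis \<open>q\<close>, and column \<open>j\<close> those of \<open>w * q j\<close> in the
  basis \<open>p\<close>.\<close>

definition L :: smat where "L = (\<lambda>i j. b (p i) (q j))"

lemma L_eq: "L i j = a (w * q j) (p i)"
  unfolding L_def b.commute[of "p i"] by (rule b_eq)

lemma L_lower: "lower_triangular L"
proof -
  have "L i j = 0" if "i < j" for i j
    unfolding L_def using that
    by (intro b.orthonormal_orthogonal[OF q]) (simp add: a.orthonormal_D(1)[OF p])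
  then show ?thesis unfolding lower_triangular_def using not_le_imp_less by blast
qed

lemma L_pos: "positive_diagonal L"
  unfolding positive_diagonal_def L_def
  by (subst b.orthonormal_lead_coeff[OF q]) (simp_all add: a.orthonormal_D[OF p] b.orthonormal_D[OF q])

text \<open>\<open>w * q j\<close> has degree at most \<open>degree w + j\<close>, so it is
  orthogonal to every later \<open>p i\<close>.\<close>

lemma L_band: "i \<le> j + degree w" if "L i j \<noteq> 0"
proof (rule ccontr)
  assume "\<not> i \<le> j + degree w"
  moreover have "degree (w * q j) \<le> degree w + j"
    using degree_mult_le[of w "q j"] unfolding b.orthonormal_D(1)[OF q] .
  ultimately have "a (w * q j) (p i) = 0"
    by (intro a.orthonormal_orthogonal[OF p]) linarith
  then show False using that unfolding L_eq by simp
qed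

lemma L_mult_transpose: "L \<otimes>\<^sub>m smat_transpose L = (\<lambda>i j. a (w * p i) (p j))"
  unfolding smat_mult_def smat_transpose_def L_def b.parseval[OF q] by (simp only: b_eq)

text \<open>Parseval for \<open>a\<close> in the basis \<open>p\<close>, applied to the columns of
  \<open>L\<close>. The result no longer mentions \<open>a\<close> or \<open>p\<close>.\<close>

lemma transpose_mult_L: "smat_transpose L \<otimes>\<^sub>m L = (\<lambda>i j. b (w * q i) (q j))"
proof (intro ext)
  fix i j
  have "(smat_transpose L \<otimes>\<^sub>m L) i j = a (w * q i) (w * q j)"
    unfolding smat_mult_def smat_transpose_def L_eq a.parseval[OF p] ..
  also have "\<dots> = b (w * q i) (q j)"
    unfolding a.commute[of "w * q i"] b.commute[of "w * q i"] by (rule b_eq[symmetric])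
  finally show "(smat_transpose L \<otimes>\<^sub>m L) i j = b (w * q i) (q j)" .
qed

end

section \<open>Uniqueness of the Cholesky factor\<close>

lemma cholesky_unique:
  assumes "lower_triangular L" "positive_diagonal L"
    and "lower_triangular K" "positive_diagonal K"
    and eq: "L \<otimes>\<^sub>m smat_transpose L = K \<otimes>\<^sub>m smat_transpose K"
  shows "L = K"
proof -
  have entry: "(A \<otimes>\<^sub>m smat_transpose A) i j = (\<Sum>k<j. A i k * A j k) + A i j * A j j"
    if "lower_triangular A" for A i j
  proof -
    have "(A \<otimes>\<^sub>m smat_transpose A) i j = (\<Sum>k\<le>j. A i k * A j k)"
      using that unfolding smat_mult_def smat_transpose_def lower_triangular_def
      by (intro suminf_finite) auto
    then show ?thesis by (simp flip: lessThan_Suc_atMost)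
  qed
  have "\<forall>i. L i j = K i j" for j
  proof (induction j rule: less_induct)
    case (less j)
    then have sums: "(\<Sum>k<j. L i k * L j k) = (\<Sum>k<j. K i k * K j k)" for i
      by (intro sum.cong) auto
    \<comment> \<open>Once the earlier columns agree, \<open>i = j\<close> determines the pivot up
      to sign, and dividing by the positive pivot determines the rest of column
      \<open>j\<close>.\<close>
    have col: "L i j * L j j = K i j * K j j" for i
      using fun_cong[OF fun_cong[OF eq], of i j] sums[of i]
      by (simp add: entry[OF assms(1)] entry[OF assms(3)])
    have pos: "L j j > 0" "K j j > 0"
      using assms by (auto simp: positive_diagonal_def)
    then have "L j j = K j j" using col[of j] by (simp add: square_eq_iff)
    then show ?case using col pos by (metis mult_right_cancel less_irrefl)
  qed
  then show ?thesis by blast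
qed

lemma (in christoffel) cholesky_L:
  assumes "degree w = 1"
  shows "cholesky (\<lambda>i j. a (w * p i) (p j)) = L"
  unfolding cholesky_def
proof (rule the_equality)
  show "lower_bidiagonal L \<and> positive_diagonal L \<and>
      (\<lambda>i j. a (w * p i) (p j)) = L \<otimes>\<^sub>m smat_transpose L"
    using L_lower L_pos L_band assms
    by (auto simp: L_mult_transpose lower_bidiagonal_def lower_triangular_def)
next
  fix K assume "lower_bidiagonal K \<and> positive_diagonal K \<and>
      (\<lambda>i j. a (w * p i) (p j)) = K \<otimes>\<^sub>m smat_transpose K"
  then have K: "lower_bidiagonal K" "positive_diagonal K"
      "K \<otimes>\<^sub>m smat_transpose K = L \<otimes>\<^sub>m smat_transpose L"
    by (simp_all only: L_mult_transpose)
  have "lower_triangular K"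
    using K(1) unfolding lower_bidiagonal_def lower_triangular_def by blast
  then show "K = L" using K(2) L_lower L_pos K(3) by (rule cholesky_unique)
qed

section \<open>Measures with infinite support\<close>

text \<open>The complement of the support is the union of all open null sets; Lindelof's theorem
  reduces it to a countable union.\<close>

lemma AE_supp:
  assumes "sets \<mu> = sets borel"
  shows "AE x in \<mu>. x \<in> supp \<mu>"
proof -
  define F where "F = {U::real set. open U \<and> emeasure \<mu> U = 0}"
  obtain F' where F': "F' \<subseteq> F" "countable F'" "\<Union>F' = \<Union>F"
    using Lindelof[of F] by (auto simp: F_def)
  have "\<Union>F' \<in> null_sets \<mu>"
    using F' assms by (intro null_sets_UN'[of F' "\<lambda>U. U", simplified])
      (auto simp: F_def null_sets_def)
  moreover have "{x \<in> space \<mu>. x \<notin> supp \<mu>} \<subseteq> \<Union>F'"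
    unfolding F'(3) by (auto simp: F_def supp_def zero_less_iff_neq_zero)
  ultimately show ?thesis by (rule AE_I')
qed

text \<open>A nonzero polynomial has finitely many roots, so it is nonzero at some support point,
  and the open set where it is nonzero then has positive measure.\<close>

lemma AE_poly_zero:
  assumes "sets \<mu> = sets borel" "infinite (supp \<mu>)" "AE x in \<mu>. poly f x = 0"
  shows "f = 0"
proof (rule ccontr)
  assume "f \<noteq> 0"
  then have "finite {x. poly f x = 0}" by (rule poly_roots_finite)
  then have "\<not> supp \<mu> \<subseteq> {x. poly f x = 0}" using assms(2) finite_subset by blast
  then obtain y where y: "y \<in> supp \<mu>" "poly f y \<noteq> 0" by blast
  have op: "open {x. poly f x \<noteq> 0}" by (intro open_Collect_neq continuous_intros)
  then have "{x. poly f x \<noteq> 0} \<in> sets \<mu>" using assms(1) by simp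
  moreover have "{x \<in> space \<mu>. poly f x \<noteq> 0} = {x. poly f x \<noteq> 0}"
    using sets_eq_imp_space_eq[OF assms(1)] by simp
  ultimately have "emeasure \<mu> {x. poly f x \<noteq> 0} = 0"
    using AE_iff_measurable[of _ \<mu> "\<lambda>x. poly f x = 0"] assms(3) by blast
  moreover have "emeasure \<mu> {x. poly f x \<noteq> 0} > 0"
    using op y unfolding supp_def by blast
  ultimately show False by simp
qed

lemma integrable_poly:
  assumes "finite_moments \<mu>"
  shows "integrable \<mu> (\<lambda>x. poly f x)"
  using assms unfolding poly_altdef finite_moments_def by auto

lemma measurable_poly:
  assumes "sets \<mu> = sets borel"
  shows "(\<lambda>x. poly f x :: real) \<in> borel_measurable \<mu>"
  unfolding measurable_cong_sets[OF assms refl]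
  by (intro borel_measurable_continuous_onI continuous_intros)

text \<open>Serves for the weights 1, \<plusminus>(x - c) and (x - c)^2. A zero integral of the
  nonnegative integrand would force \<open>f\<close> to vanish almost everywhere.\<close>

lemma poly_inner_weighted:
  assumes "sets \<mu> = sets borel" "infinite (supp \<mu>)" "finite_moments \<mu>"
    and w: "\<And>x. x \<in> supp \<mu> \<Longrightarrow> poly w x > 0"
  shows "poly_inner (\<lambda>f g. measure_ip \<mu> (w * f) g)"
proof
  have int: "integrable \<mu> (\<lambda>x. poly w x * poly f x * poly g x)" for f g
    using integrable_poly[OF assms(3), of "w * f * g"] by simp
  fix f g h :: "real poly" and r :: real
  show "measure_ip \<mu> (w * (f + g)) h = measure_ip \<mu> (w * f) h + measure_ip \<mu> (w * g) h"
    unfolding measure_ip_def by (simp add: algebra_simps flip: Bochner_Integration.integral_add)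
       (use int in \<open>simp add: algebra_simps\<close>)
  show "measure_ip \<mu> (w * smult r f) h = r * measure_ip \<mu> (w * f) h"
    unfolding measure_ip_def by (simp add: algebra_simps)
  show "measure_ip \<mu> (w * f) g = measure_ip \<mu> (w * g) f"
    unfolding measure_ip_def by (simp add: algebra_simps)
  assume f: "f \<noteq> 0"
  have supp: "AE x in \<mu>. x \<in> supp \<mu>" using assms(1) by (rule AE_supp)
  have nonneg: "AE x in \<mu>. 0 \<le> poly w x * poly f x * poly f x"
    using supp by eventually_elim (use w in \<open>force simp: mult.assoc\<close>)
  have "measure_ip \<mu> (w * f) f \<noteq> 0"
  proof
    assume "measure_ip \<mu> (w * f) f = 0"
    then have "AE x in \<mu>. poly w x * poly f x * poly f x = 0"
      using integral_nonneg_eq_0_iff_AE[OF int nonneg] by (simp add: measure_ip_def)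
    then have "AE x in \<mu>. poly f x = 0"
      using supp by eventually_elim (use w in force)
    then show False using f AE_poly_zero[OF assms(1,2)] by blast
  qed
  moreover have "measure_ip \<mu> (w * f) f \<ge> 0"
    unfolding measure_ip_def using nonneg by (simp add: integral_nonneg_AE)
  ultimately show "measure_ip \<mu> (w * f) f > 0" by simp
qed

lemma measure_ip_iterated:
  assumes "sets \<mu> = sets borel"
  shows "measure_ip (iterated_measure \<mu> c) f g = measure_ip \<mu> ([:- c, 1:]\<^sup>2 * f) g"
proof -
  have "measure_ip (iterated_measure \<mu> c) f g
      = (\<integral>x. (x - c)\<^sup>2 *\<^sub>R (poly f x * poly g x) \<partial>\<mu>)"
    unfolding measure_ip_def iterated_measure_def
    using measurable_poly[OF assms, of "f * g"] measurable_poly[OF assms, of "[:- c, 1:]\<^sup>2"]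
    by (intro integral_density) (auto simp: algebra_simps)
  then show ?thesis by (simp add: measure_ip_def algebra_simps)
qed

section \<open>Jacobi matrices as Gram matrices\<close>

lemma jacobi_matrix_eq:
  assumes "poly_inner (measure_ip \<mu>)"
  shows "jacobi_matrix \<mu> = (\<lambda>i j. measure_ip \<mu> ([:0, 1:] * op_polys \<mu> i) (op_polys \<mu> j))"
proof -
  interpret poly_inner "measure_ip \<mu>" by fact
  have p: "orthonormal_polys (measure_ip \<mu>) (op_polys \<mu>)"
    unfolding op_polys_def by (rule the_orthonormal_polys)
  define J where "J = (\<lambda>i j. measure_ip \<mu> ([:0, 1:] * op_polys \<mu> i) (op_polys \<mu> j))"
  \<comment> \<open>The factor x moves across the integral. By this symmetry the degree bound on one
    side of the diagonal also gives the other.\<close>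
  have J_sym: "J i j = J j i" for i j
    unfolding J_def measure_ip_def by (simp add: algebra_simps)
  have J_upper: "j \<le> i + 1" if "J i j \<noteq> 0" for i j
  proof (rule ccontr)
    assume "\<not> j \<le> i + 1"
    then have "degree ([:0, 1:] * op_polys \<mu> i) < j"
      using degree_mult_le[of "[:0, 1:]" "op_polys \<mu> i"] orthonormal_D(1)[OF p, of i] by simp
    then show False using that orthonormal_orthogonal[OF p] unfolding J_def by blast
  qed
  have fin: "finite {k. A i k \<noteq> 0}" if "symmetric_tridiagonal A" for A i
    by (rule finite_subset[of _ "{..i+1}"])
      (use that in \<open>auto simp: symmetric_tridiagonal_def\<close>)
  show ?thesis
    unfolding jacobi_matrix_def J_def[symmetric]
  proof (rule the_equality)
    have J: "symmetric_tridiagonal J"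
      unfolding symmetric_tridiagonal_def smat_transpose_def
    proof (intro conjI ext allI impI)
      fix i j
      show "J j i = J i j" by (rule J_sym)
      assume J: "J i j \<noteq> 0"
      then show "j \<le> i + 1" by (rule J_upper)
      show "i \<le> j + 1" using J unfolding J_sym[of i j] by (rule J_upper)
    qed
    moreover have "(\<lambda>n. [:0, 1:] * op_polys \<mu> n) = J \<cdot>\<^sub>v op_polys \<mu>"
      unfolding eq_smat_vec_iff[OF p fin[OF J]] by (rule J_def)
    ultimately show "symmetric_tridiagonal J \<and> (\<lambda>n. [:0, 1:] * op_polys \<mu> n) = J \<cdot>\<^sub>v op_polys \<mu>" ..
  next
    fix A assume "symmetric_tridiagonal A \<and> (\<lambda>n. [:0, 1:] * op_polys \<mu> n) = A \<cdot>\<^sub>v op_polys \<mu>"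
    then have A: "symmetric_tridiagonal A" "(\<lambda>n. [:0, 1:] * op_polys \<mu> n) = A \<cdot>\<^sub>v op_polys \<mu>"
      by auto
    show "A = J"
      using A(2) unfolding eq_smat_vec_iff[OF p fin[OF A(1)]] J_def .
  qed
qed

lemma shifted_jacobi_matrix:
  assumes "poly_inner (measure_ip \<mu>)"
  shows "jacobi_matrix \<mu> \<ominus>\<^sub>m c \<cdot>\<^sub>m smat_id
    = (\<lambda>i j. measure_ip \<mu> ([:- c, 1:] * op_polys \<mu> i) (op_polys \<mu> j))"
proof -
  interpret poly_inner "measure_ip \<mu>" by fact
  have p: "orthonormal_polys (measure_ip \<mu>) (op_polys \<mu>)"
    unfolding op_polys_def by (rule the_orthonormal_polys)
  have split: "[:- c, 1:] * f = [:0, 1:] * f - smult c f" for f :: "real poly"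
    by simp
  show ?thesis
    unfolding split diff smult jacobi_matrix_eq[OF assms] smat_minus_def smat_scale_def smat_id_def
    by (simp only: orthonormal_D(3)[OF p])
qed

section \<open>The Sobolev inner product and the matrix \<open>T_matrix\<close>\<close>

lemma sobolev_ip_eq:
  assumes "sets \<mu> = sets borel" "is_interval E" "supp \<mu> \<subseteq> E"
  shows "sobolev_ip \<mu> E c M N f g = measure_ip \<mu> f g + M * poly f c * poly g c
    + N * poly (pderiv f) c * poly (pderiv g) c"
proof -
  have "E \<in> sets \<mu>" using assms(1,2) is_interval_convex real_interval_borel_measurable by simp
  then have "(LINT x:E|\<mu>. poly f x * poly g x) = measure_ip \<mu> f g"
    unfolding set_lebesgue_integral_def measure_ip_def
  proof (intro integral_cong_AE)
    show "AE x in \<mu>. indicat_real E x *\<^sub>R (poly f x * poly g x) = poly f x * poly g x"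
      using AE_supp[OF assms(1)] by eventually_elim (use assms(3) in auto)
  qed (use measurable_poly[OF assms(1)] in auto)
  then show ?thesis by (simp add: sobolev_ip_def)
qed

lemma poly_inner_sobolev:
  assumes "sets \<mu> = sets borel" "is_interval E" "supp \<mu> \<subseteq> E"
    and "poly_inner (measure_ip \<mu>)" "M \<ge> 0" "N \<ge> 0"
  shows "poly_inner (sobolev_ip \<mu> E c M N)"
proof -
  interpret poly_inner "measure_ip \<mu>" by fact
  show ?thesis
  proof
    fix f g h :: "real poly" and r :: real
    note eq = sobolev_ip_eq[OF assms(1-3)]
    show "sobolev_ip \<mu> E c M N (f + g) h = sobolev_ip \<mu> E c M N f h + sobolev_ip \<mu> E c M N g h"
      unfolding eq by (simp add: add pderiv_add algebra_simps)
    show "sobolev_ip \<mu> E c M N (smult r f) h = r * sobolev_ip \<mu> E c M N f h"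
      unfolding eq by (simp add: smult pderiv_smult algebra_simps)
    show "sobolev_ip \<mu> E c M N f g = sobolev_ip \<mu> E c M N g f"
      unfolding eq by (simp add: commute[of f g])
    assume "f \<noteq> 0"
    then have "measure_ip \<mu> f f > 0" by (rule pos)
    then show "sobolev_ip \<mu> E c M N f f > 0"
      unfolding eq using assms(5,6) by (simp add: mult.assoc add_pos_nonneg)
  qed
qed

lemma T_matrix_eq:
  assumes "poly_inner (measure_ip (iterated_measure \<mu> c))"
    and T: "T = (\<lambda>i j. measure_ip (iterated_measure \<mu> c) (sobolev_polys \<mu> E c M N i)
      (op_polys (iterated_measure \<mu> c) j))"
    and "lower_triangular T" "positive_diagonal T"
  shows "T_matrix \<mu> E c M N = T"
proof -
  interpret poly_inner "measure_ip (iterated_measure \<mu> c)" by fact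
  have p: "orthonormal_polys (measure_ip (iterated_measure \<mu> c)) (op_polys (iterated_measure \<mu> c))"
    unfolding op_polys_def by (rule the_orthonormal_polys)
  have fin: "finite {k. A i k \<noteq> 0}" if "lower_triangular A" for A i
    by (rule finite_subset[of _ "{..i}"]) (use that in \<open>auto simp: lower_triangular_def\<close>)
  show ?thesis
    unfolding T_matrix_def
  proof (rule the_equality)
    show "lower_triangular T \<and> positive_diagonal T \<and>
        sobolev_polys \<mu> E c M N = T \<cdot>\<^sub>v op_polys (iterated_measure \<mu> c)"
      unfolding eq_smat_vec_iff[OF p fin[OF assms(3)]]
      by (intro conjI assms(3,4) T)
  next
    fix A assume "lower_triangular A \<and> positive_diagonal A \<and>
        sobolev_polys \<mu> E c M N = A \<cdot>\<^sub>v op_polys (iterated_measure \<mu> c)"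
    then have A: "lower_triangular A"
        "sobolev_polys \<mu> E c M N = A \<cdot>\<^sub>v op_polys (iterated_measure \<mu> c)"
      by auto
    show "A = T"
      using A(2) unfolding eq_smat_vec_iff[OF p fin[OF A(1)]] T .
  qed
qed

lemma side_sign_pos:
  assumes "is_interval E" "c \<notin> E" "x \<in> E"
  shows "side_sign E c * (x - c) > 0"
proof (cases "\<forall>y\<in>E. c < y")
  case False
  then obtain y where "y \<in> E" "y \<le> c" by force
  \<comment> \<open>Otherwise \<open>c\<close> would lie between \<open>y\<close> and
    \<open>x\<close>, hence in the interval.\<close>
  then have "x < c" using assms by (meson is_interval_1 not_le_imp_less)
  then show ?thesis using False by (simp add: side_sign_def)
qed (use assms in \<open>simp add: side_sign_def\<close>)

theorem proposition7:
  fixes \<mu> :: "real measure" and E :: "real set" and c M N :: real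
  assumes "sets \<mu> = sets borel"
    and "is_interval E"
    and "infinite (supp \<mu>)"
    and "supp \<mu> \<subseteq> E"
    and "finite_moments \<mu>"
    and "c \<notin> E"
    and "M \<ge> 0" and "N \<ge> 0"
  shows "let A = jacobi_matrix (iterated_measure \<mu> c) \<ominus>\<^sub>m c \<cdot>\<^sub>m smat_id;
             R = R_matrix \<mu> E c;
             T = T_matrix \<mu> E c M N
         in A \<otimes>\<^sub>m A = R \<otimes>\<^sub>m smat_transpose R \<and>
            R \<otimes>\<^sub>m smat_transpose R = smat_transpose T \<otimes>\<^sub>m T"
proof -
  define \<epsilon> where "\<epsilon> = side_sign E c"
  define v where "v = [:- c, 1:]"
  \<comment> \<open>The sign makes \<open>w\<close> positive on the support, so that
    \<open>m1\<close> is an inner product; it cancels in the square of \<open>w\<close>.\<close>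
  define w where "w = smult \<epsilon> v"
  have \<epsilon>2: "\<epsilon> * \<epsilon> = 1" by (simp add: \<epsilon>_def side_sign_def)
  have deg_w: "degree w = 1" using \<epsilon>2 by (auto simp: w_def v_def)
  have w2: "w * w = v\<^sup>2" by (simp add: w_def \<epsilon>2 power2_eq_square)
  have w_pos: "poly w x > 0" if "x \<in> supp \<mu>" for x
    using side_sign_pos[of E c x] that assms by (auto simp: w_def v_def \<epsilon>_def algebra_simps)
  define m where "m = measure_ip \<mu>"
  define m1 where "m1 = (\<lambda>f g. m (w * f) g)"
  define m2 where "m2 = measure_ip (iterated_measure \<mu> c)"
  define S where "S = sobolev_ip \<mu> E c M N"
  have m2_eq: "m2 f g = m (v\<^sup>2 * f) g" for f g
    using measure_ip_iterated[OF assms(1)] by (simp add: m2_def m_def v_def)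
  have m2_m1: "m2 f g = m1 (w * f) g" for f g
    by (simp add: m2_eq m1_def w2 flip: mult.assoc)
  note weighted = poly_inner_weighted[OF assms(1,3,5)]
  interpret m: poly_inner m
    using weighted[of 1] by (simp add: m_def)
  interpret m1: poly_inner m1
    using weighted[of w] w_pos by (simp add: m1_def m_def)
  interpret m2: poly_inner m2
  proof -
    have "m2 = (\<lambda>f g. measure_ip \<mu> (w * w * f) g)" by (intro ext) (simp add: m2_eq w2 m_def)
    moreover have "poly_inner \<dots>" by (intro weighted) (use w_pos in simp)
    ultimately show "poly_inner m2" by simp
  qed
  interpret S: poly_inner S
    unfolding S_def using assms m.poly_inner_axioms by (intro poly_inner_sobolev) (auto simp: m_def)

  define p where "p = op_polys \<mu>"
  define q where "q = the_orthonormal_polys m1"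
  define r where "r = op_polys (iterated_measure \<mu> c)"
  define s where "s = sobolev_polys \<mu> E c M N"
  have p: "orthonormal_polys m p"
    using m.the_orthonormal_polys by (simp add: p_def m_def op_polys_def)
  have q: "orthonormal_polys m1 q"
    using m1.the_orthonormal_polys by (simp add: q_def)
  have r: "orthonormal_polys m2 r"
    using m2.the_orthonormal_polys by (simp add: r_def m2_def op_polys_def)
  have s: "orthonormal_polys S s"
    using S.the_orthonormal_polys by (simp add: s_def S_def sobolev_polys_def)

  have v_c: "poly v c = 0" by (simp add: v_def)
  \<comment> \<open>A multiple of \<open>v\<^sup>2\<close> has a double zero at \<open>c\<close>, so
    it and its derivative vanish there and both mass terms drop out.\<close>
  have S_v2: "m2 f g = S (v\<^sup>2 * f) g" for f g
    unfolding S_def sobolev_ip_eq[OF assms(1,2,4)] m2_eq m_def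
    by (simp add: v_c pderiv_mult power2_eq_square)

  \<comment> \<open>\<open>c1\<close> and \<open>c2\<close> are the two Cholesky steps,
    \<open>cR\<close> is their composite, and \<open>cT\<close> starts from the Sobolev product.
    \<open>cR\<close> and \<open>cT\<close> end in the same \<open>m2\<close> and
    \<open>r\<close>.\<close>
  interpret c1: christoffel m m1 w p q by unfold_locales (simp add: m1_def, fact p, fact q)
  interpret c2: christoffel m1 m2 w q r by unfold_locales (fact m2_m1 q r)+
  interpret cR: christoffel m m2 "v\<^sup>2" p r by unfold_locales (fact m2_eq p r)+
  interpret cT: christoffel S m2 "v\<^sup>2" s r by unfold_locales (fact S_v2 s r)+

  have J: "\<epsilon> \<cdot>\<^sub>m (jacobi_matrix \<mu> \<ominus>\<^sub>m c \<cdot>\<^sub>m smat_id) = (\<lambda>i j. m (w * p i) (p j))"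
    using shifted_jacobi_matrix[of \<mu> c] m.poly_inner_axioms
    by (simp add: m_def[symmetric] p_def[symmetric] v_def[symmetric] smat_scale_def w_def m.smult)
  have chol: "cholesky (\<epsilon> \<cdot>\<^sub>m (jacobi_matrix \<mu> \<ominus>\<^sub>m c \<cdot>\<^sub>m smat_id)) = c1.L"
    unfolding J using deg_w by (rule c1.cholesky_L)
  \<comment> \<open>Reversing the factors gives the Gram matrix of \<open>w\<close> in the basis
    \<open>q\<close>, exactly the matrix that \<open>c2\<close> factorizes.\<close>
  have chol1: "cholesky (smat_transpose c1.L \<otimes>\<^sub>m c1.L) = c2.L"
    unfolding c1.transpose_mult_L using deg_w by (rule c2.cholesky_L)
  \<comment> \<open>The changes of basis from \<open>p\<close> to \<open>q\<close> and from
    \<open>q\<close> to \<open>r\<close> compose; the sum over \<open>q\<close> is Parseval for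
    \<open>m1\<close>.\<close>
  have "c1.L \<otimes>\<^sub>m c2.L = cR.L"
  proof (intro ext)
    fix i j
    have "(c1.L \<otimes>\<^sub>m c2.L) i j = (\<Sum>k. m1 (p i) (q k) * m1 (w * r j) (q k))"
      by (simp add: smat_mult_def c1.L_def c2.L_eq)
    also have "\<dots> = cR.L i j"
      unfolding m1.parseval[OF q] cR.L_def
      using m2_m1 m1.commute m2.commute by metis
    finally show "(c1.L \<otimes>\<^sub>m c2.L) i j = cR.L i j" .
  qed
  then have R: "R_matrix \<mu> E c = smat_transpose cR.L"
    unfolding R_matrix_def Let_def \<epsilon>_def[symmetric] chol chol1 by simp
  have T: "T_matrix \<mu> E c M N = cT.L"
    using m2.poly_inner_axioms cT.L_def cT.L_lower cT.L_pos
    unfolding m2_def r_def s_def by (rule T_matrix_eq)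
  have A: "jacobi_matrix (iterated_measure \<mu> c) \<ominus>\<^sub>m c \<cdot>\<^sub>m smat_id = (\<lambda>i j. m2 (v * r i) (r j))"
    using shifted_jacobi_matrix[of "iterated_measure \<mu> c" c] m2.poly_inner_axioms
    by (simp add: m2_def r_def v_def)
  have v_sym: "m2 (v * f) g = m2 f (v * g)" for f g
    by (simp add: m2_def measure_ip_def algebra_simps)
  have v_sym': "m2 (v * r k) (r j) = m2 (v * r j) (r k)" for j k
    using v_sym[of "r k" "r j"] m2.commute[of "v * r j" "r k"] by simp
  \<comment> \<open>By Parseval in the basis \<open>r\<close>, squaring the matrix of multiplication
    by \<open>v\<close> gives that of multiplication by \<open>v\<^sup>2\<close>.\<close>
  have "(\<Sum>k. m2 (v * r i) (r k) * m2 (v * r k) (r j)) = m2 (v * r i) (v * r j)" for i j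
    unfolding v_sym'[of _ j] by (rule m2.parseval[OF r])
  moreover have "m2 (v * r i) (v * r j) = m2 (v\<^sup>2 * r i) (r j)" for i j
    unfolding v_sym[symmetric] by (simp add: power2_eq_square mult.assoc)
  ultimately have AA: "(\<lambda>i j. m2 (v * r i) (r j)) \<otimes>\<^sub>m (\<lambda>i j. m2 (v * r i) (r j))
      = (\<lambda>i j. m2 (v\<^sup>2 * r i) (r j))"
    by (simp add: smat_mult_def)
  have RR: "smat_transpose (smat_transpose cR.L) = cR.L"
    by (simp add: smat_transpose_def)
  show ?thesis
    \<comment> \<open>All three products are now the matrix of multiplication by
      \<open>v\<^sup>2\<close> in the basis \<open>r\<close>.\<close>
    unfolding Let_def A R T RR AA cR.transpose_mult_L cT.transpose_mult_L by simp
qed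

end
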